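(* Let $0<\alpha<1$, $\lambda\ge0$, $a>0$, $y_a\in\mathbb{R}$, let $J\subseteq\mathbb{R}$ be an interval and let $f:[0,a]\times J\to\mathbb{R}$ be continuous and satisfy $|f(t,u)-f(t,v)|\le L|u-v|$ for all $t\in[0,a]$, $u,v\in J$, where $0<L<\dfrac{\Gamma(\alpha+1)}{2a^{\alpha}e^{\lambda a}}$. Let $y$ be the unique ($J$-valued) solution of $$\mathbb{D}^{\alpha,\lambda}(y(t))=f(t,y(t)),\ t\in[0,a],\quad e^{\lambda a}y(a)=y_a,$$ and, for a continuous function $\tilde f:[0,a]\times J\to\mathbb{R}$ with $f-\tilde f$ bounded, let $z$ be the unique ($J$-valued) solution of $$\mathbb{D}^{\alpha,\lambda}(z(t))=\tilde f(t,z(t)),\ t\in[0,a],\quad e^{\lambda a}z(a)=y_a.$$ Then $\|y-z\|=\mathcal{O}(\|f-\tilde f\|)$; that is, there is a constant $C>0$, independent of $\tilde f$ and $z$, such that $\|y-z\|\le C\,\|f-\tilde f\|$ for all such $\tilde f$.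
   Context: $\|g\|=\max_{t\in[0,a]}|g(t)|$ for $g\in C([0,a])$, and $\|f-\tilde f\|=\sup_{(t,u)\in[0,a]\times J}|f(t,u)-\tilde f(t,u)|$. For $0<\alpha<1$ and $\lambda\ge0$ the (left-sided) Caputo tempered fractional derivative is $$\mathbb{D}^{\alpha,\lambda}(y(t))=\frac{e^{-\lambda t}}{\Gamma(1-\alpha)}\int_0^t (t-s)^{-\alpha}\frac{d}{ds}\left(e^{\lambda s}y(s)\right)ds.$$ Solutions are understood via the equivalent integral equation: for $h\in\{f,\tilde f\}$, a solution of $\mathbb{D}^{\alpha,\lambda}(w(t))=h(t,w(t))$ on $[0,a]$ with $e^{\lambda a}w(a)=y_a$ is a continuous function $w:[0,a]\to J$ such that for all $t\in[0,a]$ $$w(t)=y_a e^{-\lambda t}-\frac{e^{-\lambda t}}{\Gamma(\alpha)}\int_0^a e^{\lambda s}(a-s)^{\alpha-1}h(s,w(s))\,ds+\frac{e^{-\lambda t}}{\Gamma(\alpha)}\int_0^t e^{\lambda s}(t-s)^{\alpha-1}h(s,w(s))\,ds.$$ The unique solutions $y$ and $z$ are assumed to exist. *)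

theory Defs
  imports "HOL-Analysis.Analysis"
begin

(* Used for a function on [0,a] and, uncurried, for one on [0,a] x J. The real supremum is
   meaningful only for a nonempty S on which g is bounded; on a nonempty compact S with
   continuous g it is a maximum (sup_norm_on_attained). *)
definition sup_norm_on :: "'a set \<Rightarrow> ('a \<Rightarrow> real) \<Rightarrow> real" where
  "sup_norm_on S g = (SUP x\<in>S. \<bar>g x\<bar>)"

lemma sup_norm_on_attained:
  fixes g :: "'a :: topological_space \<Rightarrow> real"
  assumes "compact S" "S \<noteq> {}" "continuous_on S g"
  obtains x where "x \<in> S" "sup_norm_on S g = \<bar>g x\<bar>" "\<And>y. y \<in> S \<Longrightarrow> \<bar>g y\<bar> \<le> \<bar>g x\<bar>"
proof -
  have "continuous_on S (\<lambda>x. \<bar>g x\<bar>)"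
    by (intro continuous_intros assms)
  then obtain x where x: "x \<in> S" "\<And>y. y \<in> S \<Longrightarrow> \<bar>g y\<bar> \<le> \<bar>g x\<bar>"
    using continuous_attains_sup[OF assms(1,2)] by blast
  have "sup_norm_on S g = \<bar>g x\<bar>"
    unfolding sup_norm_on_def using x by (intro cSup_eq_maximum) auto
  with x that show thesis by blast
qed

(* A J-valued solution w on [0,a] of the terminal value problem
     D^(alpha,lam) w(t) = h(t, w(t)),   exp(lam a) w(a) = ya
   for the Caputo tempered derivative D^(alpha,lam), understood through the equivalent integral
   equation; the terminal condition is the equation at t = a. The kernel value at s = t is
   0 powr (alpha - 1) = 0, a single point that does not affect the integral. Values of w
   outside [0,a] are irrelevant. *)
definition tempered_solution ::
  "real \<Rightarrow> real \<Rightarrow> real \<Rightarrow> real \<Rightarrow> real set \<Rightarrow> (real \<Rightarrow> real \<Rightarrow> real) \<Rightarrow> (real \<Rightarrow> real) \<Rightarrow> bool" where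
  "tempered_solution \<alpha> lam a ya J h w \<longleftrightarrow>
     continuous_on {0..a} w \<and> w ` {0..a} \<subseteq> J \<and>
     (\<forall>t\<in>{0..a}.
        w t = ya * exp (- lam * t)
          - exp (- lam * t) / Gamma \<alpha>
              * integral {0..a} (\<lambda>s. exp (lam * s) * (a - s) powr (\<alpha> - 1) * h s (w s))
          + exp (- lam * t) / Gamma \<alpha>
              * integral {0..t} (\<lambda>s. exp (lam * s) * (t - s) powr (\<alpha> - 1) * h s (w s)))"

definition unique_tempered_solution ::
  "real \<Rightarrow> real \<Rightarrow> real \<Rightarrow> real \<Rightarrow> real set \<Rightarrow> (real \<Rightarrow> real \<Rightarrow> real) \<Rightarrow> (real \<Rightarrow> real) \<Rightarrow> bool" where
  "unique_tempered_solution \<alpha> lam a ya J h w \<longleftrightarrow>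
     tempered_solution \<alpha> lam a ya J h w \<and>
     (\<forall>v. tempered_solution \<alpha> lam a ya J h v \<longrightarrow> (\<forall>t\<in>{0..a}. v t = w t))"

end

theory Submission
  imports Defs
begin

text \<open>
  Subtracting the two integral equations, each of the two kernels contributes at most
  \<open>a powr \<alpha> / \<alpha>\<close> times the maximum of \<open>exp (lam * s) * \<bar>f s (y s) - ft s (z s)\<bar>\<close>, and the
  last factor is at most \<open>L * M + D\<close>, where \<open>M\<close> is the norm of \<open>y - z\<close> and \<open>D\<close> that of \<open>f - ft\<close>.
  So \<open>M \<le> K * (L * M + D)\<close> with \<open>K = 2 * a powr \<alpha> * exp (lam * a) / Gamma (\<alpha> + 1)\<close>, and the
  bound on \<open>L\<close> says exactly that \<open>K * L < 1\<close>, whence \<open>M \<le> K / (1 - K * L) * D\<close>.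
\<close>

text \<open>The reflection \<open>s \<mapsto> t - s\<close> maps \<open>{0..t}\<close> onto itself
  and moves the singularity from 0 to \<open>t\<close>. Positivity of \<open>\<alpha>\<close> makes
  the exponent exceed -1, so the power is integrable at its singularity.\<close>

lemma has_integral_reflected_powr:
  fixes \<alpha> t :: real
  assumes "0 < \<alpha>" and "0 \<le> t"
  shows "((\<lambda>s. (t - s) powr (\<alpha> - 1)) has_integral (t powr \<alpha> / \<alpha>)) {0..t}"
proof -
  have "((\<lambda>x. x powr (\<alpha> - 1)) has_integral (t powr \<alpha> / \<alpha>)) (cbox 0 t)"
    using has_integral_powr_from_0[of "\<alpha> - 1" t] assms by simp
  from has_integral_affinity[OF this, of "-1" t]
  have "((\<lambda>s. (t - s) powr (\<alpha> - 1)) has_integral (t powr \<alpha> / \<alpha>))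
          ((\<lambda>x. t - x) ` {0..t})"
    by (simp add: o_def)
  moreover have "(\<lambda>x. t - x) ` {0..t} = {0..t}"
    using assms(2) by (simp add: image_diff_atLeastAtMost)
  ultimately show ?thesis by simp
qed

lemma reflected_powr_mult_integrable_on:
  fixes \<alpha> t :: real and g :: "real \<Rightarrow> real"
  assumes "0 < \<alpha>" and "0 \<le> t" and g: "continuous_on {0..t} g"
  shows "(\<lambda>s. (t - s) powr (\<alpha> - 1) * g s) integrable_on {0..t}"
proof -
  have "(\<lambda>s. (t - s) powr (\<alpha> - 1)) absolutely_integrable_on {0..t}"
    using has_integral_reflected_powr[OF assms(1,2)]
    by (intro nonnegative_absolutely_integrable_1) (auto simp: has_integral_iff)
  moreover have "bounded (g ` {0..t})"
    using g by (intro compact_imp_bounded compact_continuous_image) auto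
  moreover have "g \<in> borel_measurable (lebesgue_on {0..t})"
    using g by (intro continuous_imp_measurable_on_sets_lebesgue) auto
  ultimately have "(\<lambda>s. g s * (t - s) powr (\<alpha> - 1)) absolutely_integrable_on {0..t}"
    by (intro absolutely_integrable_bounded_measurable_product_real) auto
  then show ?thesis
    by (simp add: mult.commute set_lebesgue_integral_eq_integral(1))
qed

text \<open>The kernel is nonnegative with total mass \<open>t powr \<alpha> / \<alpha>\<close>, so
  a uniform bound on \<open>g - h\<close> passes through the integral at the cost of that
  factor.\<close>

lemma integral_reflected_powr_mult_diff_le:
  fixes \<alpha> t B :: real and g h :: "real \<Rightarrow> real"
  assumes "0 < \<alpha>" and "0 \<le> t"
    and g: "continuous_on {0..t} g" and h: "continuous_on {0..t} h"
    and B: "\<And>s. s \<in> {0..t} \<Longrightarrow> \<bar>g s - h s\<bar> \<le> B"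
  shows "\<bar>integral {0..t} (\<lambda>s. (t - s) powr (\<alpha> - 1) * g s)
            - integral {0..t} (\<lambda>s. (t - s) powr (\<alpha> - 1) * h s)\<bar> \<le> B * t powr \<alpha> / \<alpha>"
proof -
  have int: "(\<lambda>s. (t - s) powr (\<alpha> - 1) * k s) integrable_on {0..t}"
    if "continuous_on {0..t} k" for k
    by (rule reflected_powr_mult_integrable_on[OF assms(1,2) that])
  have bnd: "((\<lambda>s. B * (t - s) powr (\<alpha> - 1)) has_integral B * (t powr \<alpha> / \<alpha>)) {0..t}"
    by (rule has_integral_mult_right[OF has_integral_reflected_powr[OF assms(1,2)]])
  have "norm (integral {0..t} (\<lambda>s. (t - s) powr (\<alpha> - 1) * (g s - h s)))
      \<le> integral {0..t} (\<lambda>s. B * (t - s) powr (\<alpha> - 1))"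
  proof (rule integral_norm_bound_integral)
    show "(\<lambda>s. (t - s) powr (\<alpha> - 1) * (g s - h s)) integrable_on {0..t}"
      using g h by (intro int continuous_intros)
    show "norm ((t - s) powr (\<alpha> - 1) * (g s - h s)) \<le> B * (t - s) powr (\<alpha> - 1)"
      if "s \<in> {0..t}" for s
      using mult_right_mono[OF B[OF that], of "(t - s) powr (\<alpha> - 1)"]
      by (simp add: abs_mult mult.commute)
  qed (use bnd in \<open>auto simp: has_integral_iff\<close>)
  moreover have "integral {0..t} (\<lambda>s. (t - s) powr (\<alpha> - 1) * (g s - h s))
      = integral {0..t} (\<lambda>s. (t - s) powr (\<alpha> - 1) * g s)
        - integral {0..t} (\<lambda>s. (t - s) powr (\<alpha> - 1) * h s)"
    unfolding right_diff_distrib by (intro integral_diff int g h)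
  ultimately show ?thesis
    unfolding integral_unique[OF bnd] by simp
qed

text \<open>Boundedness stands in for compactness: \<open>J\<close> may be unbounded or not closed,
  so the norm of \<open>f - ft\<close> need not be attained.\<close>

lemma abs_le_sup_norm_on:
  assumes "bounded (g ` S)" and "x \<in> S"
  shows "\<bar>g x\<bar> \<le> sup_norm_on S g"
proof -
  obtain M where "\<forall>x\<in>S. \<bar>g x\<bar> \<le> M"
    using assms(1) by (auto simp: bounded_iff)
  then have "bdd_above ((\<lambda>x. \<bar>g x\<bar>) ` S)" by (auto simp: bdd_above_def)
  with assms(2) show ?thesis
    unfolding sup_norm_on_def by (rule cSUP_upper)
qed

text \<open>The purely linear part of the argument: the nonlinearities enter only through the bound
  \<open>B\<close> along the two solutions, and the Lipschitz condition is used later to supply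
  \<open>B\<close>.\<close>

lemma tempered_solution_diff_le:
  fixes \<alpha> lam a ya B t :: real
  assumes "0 < \<alpha>" and "0 \<le> lam" and "t \<in> {0..a}"
    and f: "continuous_on ({0..a} \<times> J) (\<lambda>(t, u). f t u)"
    and g: "continuous_on ({0..a} \<times> J) (\<lambda>(t, u). g t u)"
    and y: "tempered_solution \<alpha> lam a ya J f y"
    and z: "tempered_solution \<alpha> lam a ya J g z"
    and B: "\<And>s. s \<in> {0..a} \<Longrightarrow> \<bar>f s (y s) - g s (z s)\<bar> \<le> B"
  shows "\<bar>y t - z t\<bar> \<le> 2 * a powr \<alpha> * exp (lam * a) / Gamma (\<alpha> + 1) * B"
proof -
  \<comment> \<open>Both integrals in the solution formula are values of \<open>I h w\<close>, at
    \<open>a\<close> and at \<open>t\<close>, so one estimate in \<open>\<tau>\<close> serves for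
    both.\<close>
  define I where "I h w \<tau> = integral {0..\<tau>} (\<lambda>s. exp (lam * s) * (\<tau> - s) powr (\<alpha> - 1) * h s (w s))"
    for h :: "real \<Rightarrow> real \<Rightarrow> real" and w \<tau>
  have "B \<ge> 0" using B[of t] assms(3) by force
  have Gpos: "Gamma \<alpha> > 0" using assms(1) by (rule Gamma_real_pos)
  have Gamma_plus1': "Gamma (\<alpha> + 1) = \<alpha> * Gamma \<alpha>"
    using assms(1) by (intro Gamma_plus1) (auto dest: nonpos_Ints_nonpos)
  have cont: "continuous_on {0..a} (\<lambda>s. h s (w s))"
    if "continuous_on ({0..a} \<times> J) (\<lambda>(t, u). h t u)" "tempered_solution \<alpha> lam a ya J h w" for h w
  proof -
    have "continuous_on {0..a} (\<lambda>s. (\<lambda>(t, u). h t u) (s, w s))"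
      using that(2)
      by (intro continuous_on_compose2[OF that(1)] continuous_intros)
         (auto simp: tempered_solution_def)
    then show ?thesis by simp
  qed
  have I_diff: "\<bar>I f y \<tau> - I g z \<tau>\<bar> \<le> exp (lam * a) * B * a powr \<alpha> / \<alpha>"
    if "\<tau> \<in> {0..a}" for \<tau>
  proof -
    have "\<bar>integral {0..\<tau>} (\<lambda>s. (\<tau> - s) powr (\<alpha> - 1) * (exp (lam * s) * f s (y s)))
         - integral {0..\<tau>} (\<lambda>s. (\<tau> - s) powr (\<alpha> - 1) * (exp (lam * s) * g s (z s)))\<bar>
         \<le> (exp (lam * a) * B) * \<tau> powr \<alpha> / \<alpha>"
    proof (rule integral_reflected_powr_mult_diff_le)
      have sub: "{0..\<tau>} \<subseteq> {0..a}" using that by auto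
      show "continuous_on {0..\<tau>} (\<lambda>s. exp (lam * s) * f s (y s))"
        "continuous_on {0..\<tau>} (\<lambda>s. exp (lam * s) * g s (z s))"
        using continuous_on_subset[OF cont[OF f y] sub] continuous_on_subset[OF cont[OF g z] sub]
        by (auto intro!: continuous_intros)
      fix s assume s: "s \<in> {0..\<tau>}"
      then have "exp (lam * s) * \<bar>f s (y s) - g s (z s)\<bar> \<le> exp (lam * a) * B"
        using that assms(2) by (intro mult_mono B) (auto intro!: mult_left_mono)
      then show "\<bar>exp (lam * s) * f s (y s) - exp (lam * s) * g s (z s)\<bar> \<le> exp (lam * a) * B"
        by (simp add: abs_mult flip: right_diff_distrib)
    qed (use assms(1) that in auto)
    \<comment> \<open>Enlarging \<open>\<tau>\<close> to \<open>a\<close> makes the bound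
      independent of \<open>\<tau>\<close>; this uses \<open>B \<ge> 0\<close>.\<close>
    also have "\<dots> \<le> (exp (lam * a) * B) * a powr \<alpha> / \<alpha>"
      using that assms(1) \<open>B \<ge> 0\<close>
      by (intro divide_right_mono mult_left_mono powr_mono2) auto
    finally show ?thesis by (simp add: I_def mult_ac)
  qed
  have sol: "w t = ya * exp (- lam * t) - exp (- lam * t) / Gamma \<alpha> * I h w a
      + exp (- lam * t) / Gamma \<alpha> * I h w t" if "tempered_solution \<alpha> lam a ya J h w" for h w
    using that[unfolded tempered_solution_def, THEN conjunct2, THEN conjunct2, THEN bspec, OF assms(3)]
    unfolding I_def .
  have factor: "(A - c * X + c * U) - (A - c * Y + c * V) = c * ((U - V) - (X - Y))"
    for A c X Y U V :: real
    by (simp add: algebra_simps)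
  \<comment> \<open>The two problems share the terminal value \<open>ya\<close>, so the terms
    \<open>ya * exp (- lam * t)\<close> cancel.\<close>
  have "y t - z t = exp (- lam * t) / Gamma \<alpha> * ((I f y t - I g z t) - (I f y a - I g z a))"
    unfolding sol[OF y] sol[OF z] by (rule factor)
  then have "\<bar>y t - z t\<bar> = exp (- lam * t) / Gamma \<alpha> * \<bar>(I f y t - I g z t) - (I f y a - I g z a)\<bar>"
    using Gpos by (simp add: abs_mult)
  \<comment> \<open>The factor 2 counts the integrals up to \<open>t\<close> and up to
    \<open>a\<close>; \<open>exp (- lam * t) \<le> 1\<close> because \<open>lam\<close> and
    \<open>t\<close> are nonnegative.\<close>
  also have "\<dots> \<le> 1 / Gamma \<alpha> * (2 * (exp (lam * a) * B * a powr \<alpha> / \<alpha>))"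
  proof (rule mult_mono)
    show "exp (- lam * t) / Gamma \<alpha> \<le> 1 / Gamma \<alpha>"
      using Gpos assms(2,3) by (intro divide_right_mono) auto
    have "a \<in> {0..a}" using assms(3) by auto
    from I_diff[OF this] I_diff[OF assms(3)]
    show "\<bar>(I f y t - I g z t) - (I f y a - I g z a)\<bar> \<le> 2 * (exp (lam * a) * B * a powr \<alpha> / \<alpha>)"
      by linarith
  qed (use Gpos in auto)
  also have "\<dots> = 2 * a powr \<alpha> * exp (lam * a) / Gamma (\<alpha> + 1) * B"
    by (simp add: Gamma_plus1' mult_ac)
  finally show ?thesis .
qed

theorem theorem7:
  fixes \<alpha> lam a ya L :: real and J :: "real set"
    and f :: "real \<Rightarrow> real \<Rightarrow> real" and y :: "real \<Rightarrow> real"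
  assumes "0 < \<alpha>" and "\<alpha> < 1" and "0 \<le> lam" and "0 < a"
    and "is_interval J"
    and "continuous_on ({0..a} \<times> J) (\<lambda>(t, u). f t u)"
    and "\<And>t u v. t \<in> {0..a} \<Longrightarrow> u \<in> J \<Longrightarrow> v \<in> J \<Longrightarrow> \<bar>f t u - f t v\<bar> \<le> L * \<bar>u - v\<bar>"
    and "0 < L" and "L < Gamma (\<alpha> + 1) / (2 * a powr \<alpha> * exp (lam * a))"
    and "unique_tempered_solution \<alpha> lam a ya J f y"
  shows "\<exists>C>0. \<forall>(ft :: real \<Rightarrow> real \<Rightarrow> real) (z :: real \<Rightarrow> real).
           continuous_on ({0..a} \<times> J) (\<lambda>(t, u). ft t u) \<longrightarrow>
           bounded ((\<lambda>(t, u). f t u - ft t u) ` ({0..a} \<times> J)) \<longrightarrow>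
           unique_tempered_solution \<alpha> lam a ya J ft z \<longrightarrow>
           sup_norm_on {0..a} (\<lambda>t. y t - z t)
             \<le> C * sup_norm_on ({0..a} \<times> J) (\<lambda>(t, u). f t u - ft t u)"
proof -
  define K where "K = 2 * a powr \<alpha> * exp (lam * a) / Gamma (\<alpha> + 1)"
  have Gpos: "Gamma (\<alpha> + 1) > 0" using assms(1) by (intro Gamma_real_pos) simp
  have K: "K > 0" using Gpos \<open>0 < a\<close> by (simp add: K_def)
  have KL: "K * L < 1" using assms(9) Gpos \<open>0 < a\<close> by (simp add: K_def field_simps)
  have y: "tempered_solution \<alpha> lam a ya J f y"
    using assms(10) by (simp add: unique_tempered_solution_def)
  show ?thesis
  \<comment> \<open>The witness is fixed before \<open>ft\<close> and \<open>z\<close> are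
    introduced and involves only \<open>\<alpha>\<close>, \<open>lam\<close>, \<open>a\<close> and
    \<open>L\<close>.\<close>
  proof (intro exI[of _ "K / (1 - K * L)"] conjI allI impI)
    show "K / (1 - K * L) > 0" using K KL by simp
  next
    fix ft :: "real \<Rightarrow> real \<Rightarrow> real" and z
    assume ft: "continuous_on ({0..a} \<times> J) (\<lambda>(t, u). ft t u)"
      and bdd: "bounded ((\<lambda>(t, u). f t u - ft t u) ` ({0..a} \<times> J))"
      and "unique_tempered_solution \<alpha> lam a ya J ft z"
    then have z: "tempered_solution \<alpha> lam a ya J ft z"
      by (simp add: unique_tempered_solution_def)
    define M where "M = sup_norm_on {0..a} (\<lambda>t. y t - z t)"
    define D where "D = sup_norm_on ({0..a} \<times> J) (\<lambda>(t, u). f t u - ft t u)"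
    have J: "y s \<in> J" "z s \<in> J" if "s \<in> {0..a}" for s
      using y z that by (auto simp: tempered_solution_def)
    have "continuous_on {0..a} (\<lambda>t. y t - z t)"
      using y z by (auto simp: tempered_solution_def intro!: continuous_intros)
    \<comment> \<open>The maximum is attained, so the pointwise estimate at this single
      \<open>t\<close> bounds the whole norm \<open>M\<close>.\<close>
    then obtain t where t: "t \<in> {0..a}" "M = \<bar>y t - z t\<bar>"
      and max: "\<And>s. s \<in> {0..a} \<Longrightarrow> \<bar>y s - z s\<bar> \<le> \<bar>y t - z t\<bar>"
      using \<open>0 < a\<close> unfolding M_def
      by (elim sup_norm_on_attained[OF compact_Icc, rotated]) auto
    \<comment> \<open>Insert the intermediate value \<open>f s (z s)\<close>: the Lipschitz
      condition handles the change of solution, \<open>D\<close> the change of right-hand side. Both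
      apply because \<open>y s\<close> and \<open>z s\<close> lie in \<open>J\<close>.\<close>
    have "\<bar>f s (y s) - ft s (z s)\<bar> \<le> L * M + D" if s: "s \<in> {0..a}" for s
    proof -
      have "\<bar>f s (y s) - f s (z s)\<bar> \<le> L * \<bar>y s - z s\<bar>"
        using assms(7) s J by blast
      also have "\<dots> \<le> L * M"
        using max[OF s] t(2) \<open>0 < L\<close> by (intro mult_left_mono) auto
      finally have "\<bar>f s (y s) - f s (z s)\<bar> \<le> L * M" .
      moreover have "\<bar>f s (z s) - ft s (z s)\<bar> \<le> D"
        using abs_le_sup_norm_on[OF bdd, of "(s, z s)"] s J by (simp add: D_def)
      ultimately show ?thesis by linarith
    qed
    from tempered_solution_diff_le[OF assms(1,3) t(1) assms(6) ft y z this]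
    have "M \<le> K * (L * M + D)" by (simp add: t(2) K_def)
    \<comment> \<open>The term \<open>K * L * M\<close> is absorbed on the left; dividing by
      \<open>1 - K * L\<close> keeps the inequality since that factor is positive.\<close>
    then have "M \<le> K / (1 - K * L) * D" using KL by (simp add: field_simps)
    then show "sup_norm_on {0..a} (\<lambda>t. y t - z t)
        \<le> K / (1 - K * L) * sup_norm_on ({0..a} \<times> J) (\<lambda>(t, u). f t u - ft t u)"
      by (simp add: M_def D_def)
  qed
qed

end
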